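(* Let $G$ be a connected good bi-expander and let $v_0\in V(G)$. Let $f$ be a uniformly random element of $\mathrm{Hom}_{v_0}(G)$. Then for every integer $t\ge1$ and every $v\in V(G)$, $$\mathbb{P}\big(|f(v)-\mathrm{phase}(f)|>t\big)\le\exp\left(-\frac{|B(v,t)|}{3}\right).$$
   Context: Graphs are finite, simple and undirected; $\log$ is the natural logarithm. For a graph $G$ and $v_0\in V(G)$, $\mathrm{Hom}_{v_0}(G)$ is the set of all $f:V(G)\to\mathbb{Z}$ with $f(v_0)=0$ and $|f(u)-f(v)|=1$ for every edge $\{u,v\}$ of $G$; it is finite and nonempty when $G$ is finite, connected and bipartite. For $S,T\subseteq V(G)$, $e(S,T)$ is the number of pairs $(a,b)\in S\times T$ with $\{a,b\}\in E(G)$. A $d$-regular bipartite graph $G$ with $2n$ vertices and color classes $V_0,V_1$ is a $\lambda$-bi-expander ($\lambda$ real) if $\left|e(S,T)-\frac dn|S||T|\right|\le\lambda\sqrt{|S||T|}$ for all $S\subseteq V_0$, $T\subseteq V_1$. $G$ is a good bi-expander if it is a $d$-regular $\lambda$-bi-expander with $d\ge2$ and $\lambda\le\frac{d}{300\log d}$. The color classes are named so that $v_0\in V_0$. For $f\in\mathrm{Hom}_{v_0}(G)$, there exist $i\in\{0,1\}$ and $k\in\mathbb{Z}$ such that $|\{w\in V_i: f(w)\neq k\}|\le\frac{2\lambda n}{d}$. Let $i^*$ be the smallest $i\in\{0,1\}$ for which such a $k$ exists; $\mathrm{phase}(f)$ is the smallest $k$ satisfying this inequality for $i=i^*$. $B(v,t)$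 is the set of vertices at graph distance at most $t$ from $v$ in $G$. *)

theory Defs
  imports
    "HOL-Probability.Probability"
    "Graph_Theory.Pair_Digraph"
    "Graph_Theory.Digraph_Component"
    "Graph_Theory.Shortest_Path"
begin

text \<open>
  A finite simple undirected graph is a \<^locale>\<open>pair_graph\<close>: each edge is represented by
  its two orientations in \<^const>\<open>parcs\<close>.  The two color classes of a bipartite graph are given
  as \<open>V 0\<close> and \<open>V 1\<close>; the values of \<open>V\<close> at other indices are irrelevant.
\<close>

definition color_classes :: "'a pair_pre_digraph \<Rightarrow> (nat \<Rightarrow> 'a set) \<Rightarrow> bool" where
  "color_classes G V \<longleftrightarrow>
     V 0 \<union> V 1 = pverts G \<and> V 0 \<inter> V 1 = {} \<and>
     (\<forall>(u, w) \<in> parcs G. u \<in> V 0 \<longleftrightarrow> w \<in> V 1)"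

definition edge_count :: "'a pair_pre_digraph \<Rightarrow> 'a set \<Rightarrow> 'a set \<Rightarrow> nat" where
  "edge_count G S T = card {(a, b). a \<in> S \<and> b \<in> T \<and> (a, b) \<in> parcs G}"

definition regular :: "'a pair_pre_digraph \<Rightarrow> nat \<Rightarrow> bool" where
  "regular G d \<longleftrightarrow> (\<forall>u \<in> pverts G. out_degree (with_proj G) u = d)"

definition bi_expander ::
    "'a pair_pre_digraph \<Rightarrow> (nat \<Rightarrow> 'a set) \<Rightarrow> nat \<Rightarrow> nat \<Rightarrow> real \<Rightarrow> bool" where
  "bi_expander G V n d lam \<longleftrightarrow>
     pair_graph G \<and> card (pverts G) = 2 * n \<and> color_classes G V \<and> regular G d \<and>
     (\<forall>S T. S \<subseteq> V 0 \<longrightarrow> T \<subseteq> V 1 \<longrightarrow>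
        \<bar>real (edge_count G S T) - real d / real n * real (card S) * real (card T)\<bar>
          \<le> lam * sqrt (real (card S) * real (card T)))"

definition good_bi_expander ::
    "'a pair_pre_digraph \<Rightarrow> (nat \<Rightarrow> 'a set) \<Rightarrow> nat \<Rightarrow> nat \<Rightarrow> real \<Rightarrow> bool" where
  "good_bi_expander G V n d lam \<longleftrightarrow>
     bi_expander G V n d lam \<and> d \<ge> 2 \<and> lam \<le> real d / (300 * ln (real d))"

text \<open>
  Functions are extensional, i.e. take a fixed default value outside the vertex set, so that
  each function on the vertex set is counted exactly once.
\<close>

definition Hom :: "'a pair_pre_digraph \<Rightarrow> 'a \<Rightarrow> ('a \<Rightarrow> int) set" where
  "Hom G v\<^sub>0 =
     {f \<in> pverts G \<rightarrow>\<^sub>E UNIV. f v\<^sub>0 = 0 \<and> (\<forall>(u, w) \<in> parcs G. \<bar>f u - f w\<bar> = 1)}"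

definition almost_constant ::
    "(nat \<Rightarrow> 'a set) \<Rightarrow> nat \<Rightarrow> nat \<Rightarrow> real \<Rightarrow> ('a \<Rightarrow> int) \<Rightarrow> nat \<Rightarrow> int \<Rightarrow> bool" where
  "almost_constant V n d lam f i k \<longleftrightarrow>
     real (card {w \<in> V i. f w \<noteq> k}) \<le> 2 * lam * real n / real d"

definition phase_class ::
    "(nat \<Rightarrow> 'a set) \<Rightarrow> nat \<Rightarrow> nat \<Rightarrow> real \<Rightarrow> ('a \<Rightarrow> int) \<Rightarrow> nat" where
  "phase_class V n d lam f = (LEAST i. i \<in> {0, 1} \<and> (\<exists>k. almost_constant V n d lam f i k))"

text \<open>
  The integers are not well-ordered, but for a good bi-expander \<open>2 * lam * n / d < n\<close>, so
  any admissible \<open>k\<close> is attained by \<open>f\<close> on a finite color class and the least one exists.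
\<close>

definition phase ::
    "(nat \<Rightarrow> 'a set) \<Rightarrow> nat \<Rightarrow> nat \<Rightarrow> real \<Rightarrow> ('a \<Rightarrow> int) \<Rightarrow> int" where
  "phase V n d lam f = (LEAST k. almost_constant V n d lam f (phase_class V n d lam f) k)"

text \<open>Graph distance is the shortest-path distance for unit arc weights.\<close>

definition graph_ball :: "'a pair_pre_digraph \<Rightarrow> 'a \<Rightarrow> nat \<Rightarrow> 'a set" where
  "graph_ball G v t =
     {w \<in> pverts G. wf_digraph.\<mu> (with_proj G) (\<lambda>_. 1) v w \<le> ereal (real t)}"

end

theory Submission
  imports Defs
begin

text \<open>
  A homomorphism far from its phase at \<open>v\<close> contains a large excursion around \<open>v\<close>, and an excursion
  costs much more entropy than the choice of its location and shape can repay.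

  Let \<open>f\<close> have phase \<open>k\<close>, taken on almost all of the color class \<open>V i\<close>, and suppose that
  \<open>f v > k + t\<close>; the opposite deviation becomes this one after a reflection of \<open>f\<close>. Put
  \<open>h = f - k\<close>. Starting from \<open>v\<close>, or from a neighbor of \<open>v\<close> if \<open>v\<close> is not in \<open>V i\<close>, explore \<open>V i\<close> in
  steps through common neighbors, staying where \<open>h \<ge> 2\<close>. The set \<open>S\<close> found is the excursion; let
  \<open>T\<close> be its neighborhood. A vertex outside \<open>S\<close> adjacent to \<open>T\<close> has height \<open>0\<close>, so \<open>h\<close> can be
  flattened: set it to \<open>0\<close> on \<open>S\<close> and to arbitrary signs on \<open>T\<close>. A vertex of \<open>T\<close> with a neighbor
  outside \<open>S\<close> had height \<open>1\<close>. The other vertices of \<open>T\<close>, of which there are at most \<open>|S|\<close> by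
  regularity, had one of two heights given \<open>h\<close> on \<open>S\<close>, and their sign can record which. So, once \<open>S\<close>
  and \<open>h\<close> on \<open>S\<close> are given, every \<open>h\<close> has at least \<open>2 ^ (|T| - |S|)\<close> flattened versions, and \<open>h\<close> can
  be read off from each of them (\<open>card_heights_with_profile_le\<close>).

  As \<open>h\<close> does not vanish on \<open>S\<close>, the set \<open>S\<close> is small, and expansion gives
  \<open>|T| \<ge> 75 ln d |S|\<close> (\<open>small_set_expands\<close>). On the other hand, \<open>S\<close> together with the heights on it
  is connected in a graph of degree at most \<open>3 d\<^sup>2\<close>, which leaves only
  \<open>exp (O(|S| ln d))\<close> possibilities (\<open>profile_is_trace\<close>, \<open>card_traces_le\<close>). Finally \<open>h \<ge> 1\<close> on the ball
  of radius \<open>t\<close> around \<open>v\<close>, so \<open>S\<close> and \<open>T\<close> cover it (\<open>graph_ball_subset_excursion\<close>), and the ball is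
  hardly larger than \<open>T\<close>. A union bound over all excursions, the two classes \<open>V i\<close> and the two
  directions of deviation gives the claim.

  That a phase exists at all (\<open>exists_almost_constant\<close>) is again expansion: two sets in opposite classes
  without an edge between them cannot both be large, so \<open>f\<close> cannot be low on much of one class and
  high on much of the other.
\<close>

section \<open>Counting connected sets\<close>

text \<open>
  The sets of vertices visited by the walks of length \<open>l\<close> from \<open>r\<close>. Keeping only the visited set
  lets the count of walks bound a number of sets directly.
\<close>

primrec traces :: "'b rel \<Rightarrow> nat \<Rightarrow> 'b \<Rightarrow> 'b set set" where
  "traces E 0 r = {{r}}"
| "traces E (Suc l) r = (\<Union>a\<in>E `` {r}. insert r ` traces E l a)"

lemma card_traces_le:
  assumes "\<And>a. finite (E `` {a})" and "\<And>a. card (E `` {a}) \<le> D"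
  shows "finite (traces E l r) \<and> card (traces E l r) \<le> D ^ l"
proof (induction l arbitrary: r)
  case (Suc l)
  have "card (traces E (Suc l) r) \<le> (\<Sum>a\<in>E `` {r}. card (insert r ` traces E l a))"
    using card_UN_le[OF assms(1)] by simp
  also have "\<dots> \<le> (\<Sum>a\<in>E `` {r}. D ^ l)"
    by (intro sum_mono order_trans[OF card_image_le]) (use Suc in auto)
  also have "\<dots> \<le> D ^ Suc l"
    using assms(2)[of r] by simp
  finally show ?case
    using assms(1) Suc by auto
qed simp

lemma root_in_trace: "X \<in> traces E l r \<Longrightarrow> r \<in> X"
  by (cases l) auto

text \<open>
  The first time the walk is at \<open>y\<close>, let it go to \<open>z\<close> and come back.
\<close>

lemma trace_detour:
  assumes "X \<in> traces E l r" "y \<in> X" "(y, z) \<in> E" "(z, y) \<in> E"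
  shows "insert z X \<in> traces E (Suc (Suc l)) r"
  using assms
proof (induction l arbitrary: r X)
  case 0
  then show ?case by (auto simp: insert_commute)
next
  case (Suc l)
  show ?case
  proof (cases "y = r")
    case True
    have "insert r (insert z X) \<in> traces E (Suc (Suc (Suc l))) r"
      using Suc.prems True by (auto simp del: traces.simps(2) simp: traces.simps(2)[of E "Suc (Suc l)"] traces.simps(2)[of E "Suc l"])
    then show ?thesis
      using root_in_trace[OF Suc.prems(1)] by (simp add: insert_commute insert_absorb del: traces.simps)
  next
    case False
    from Suc.prems(1) obtain a X' where a: "(r, a) \<in> E" "X' \<in> traces E l a" "X = insert r X'"
      by auto
    then have "insert z X' \<in> traces E (Suc (Suc l)) a"
      using Suc False by blast
    then have "insert r (insert z X') \<in> traces E (Suc (Suc (Suc l))) r"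
      using a(1) by (auto simp del: traces.simps(2) simp: traces.simps(2)[of E "Suc (Suc l)"])
    then show ?thesis
      by (subst a(3)) (subst insert_commute)
  qed
qed

text \<open>
  A connected set is grown one vertex at a time, and each new vertex is reached by a detour of length
  two. This is a depth-first traversal of a spanning tree, without the tree.
\<close>

lemma connected_set_is_trace:
  assumes "finite P" "r \<in> P" "sym E"
    and conn: "\<And>y. y \<in> P \<Longrightarrow> (r, y) \<in> (E \<inter> P \<times> P)\<^sup>*"
  shows "P \<in> traces E (2 * (card P - 1)) r"
proof -
  have "\<exists>X\<subseteq>P. card X = Suc j \<and> X \<in> traces E (2 * j) r" if "j < card P" for j
    using that
  proof (induction j)
    case 0
    show ?case using \<open>r \<in> P\<close> by (intro exI[of _ "{r}"]) auto
  next
    case (Suc j)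
    then obtain X where X: "X \<subseteq> P" "card X = Suc j" "X \<in> traces E (2 * j) r"
      using Suc_lessD by blast
    have "\<exists>y z. y \<in> X \<and> z \<in> P - X \<and> (y, z) \<in> E"
    proof (rule ccontr)
      assume closed: "\<not> ?thesis"
      have "y \<in> X" if "(r, y) \<in> (E \<inter> P \<times> P)\<^sup>*" for y
        using that
      proof induction
        case base
        show ?case using X(3) by (rule root_in_trace)
      next
        case (step y z)
        then show ?case using closed by blast
      qed
      then have "X = P" using conn X(1) by blast
      then show False using X(2) Suc.prems by simp
    qed
    then obtain y z where yz: "y \<in> X" "z \<in> P - X" "(y, z) \<in> E" by blast
    then have "insert z X \<in> traces E (Suc (Suc (2 * j))) r"
      using trace_detour[OF X(3)] symD[OF \<open>sym E\<close>] by blast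
    then have "insert z X \<in> traces E (2 * Suc j) r" by (simp del: traces.simps)
    moreover have "card (insert z X) = Suc (Suc j)"
      using yz X finite_subset[OF X(1) \<open>finite P\<close>] by simp
    ultimately show ?case
      using X(1) yz(2) by (intro exI[of _ "insert z X"]) (simp del: traces.simps)
  qed
  moreover have card_pos: "card P > 0"
    using assms(1,2) by (auto simp: card_gt_0_iff)
  ultimately obtain X where X: "X \<subseteq> P" "card X = Suc (card P - 1)" "X \<in> traces E (2 * (card P - 1)) r"
    by (meson diff_less zero_less_one)
  then have "X = P"
    using card_pos by (intro card_subset_eq[OF \<open>finite P\<close>]) auto
  then show ?thesis using X(3) by simp
qed

section \<open>Regular connected bi-expanders\<close>

locale connected_good_bi_expander =
  fixes G :: "'a pair_pre_digraph" and V :: "nat \<Rightarrow> 'a set" and n d :: nat and lam :: real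
  assumes good: "good_bi_expander G V n d lam"
    and conn: "Digraph_Component.connected (with_proj G)"
begin

lemma pair_graph: "pair_graph G"
  using good by (simp add: good_bi_expander_def bi_expander_def)

lemma edge_in_verts: "(u, w) \<in> parcs G \<Longrightarrow> u \<in> pverts G \<and> w \<in> pverts G"
proof -
  interpret pair_graph G by (rule pair_graph)
  show "(u, w) \<in> parcs G \<Longrightarrow> ?thesis" by (auto dest: wellformed')
qed

lemma edge_sym: "(u, w) \<in> parcs G \<Longrightarrow> (w, u) \<in> parcs G"
proof -
  interpret pair_graph G by (rule pair_graph)
  show "(u, w) \<in> parcs G \<Longrightarrow> ?thesis" using pair_sym_arcs by (auto simp: symmetric_def dest: symD)
qed

lemma finite_verts: "finite (pverts G)" and finite_edges: "finite (parcs G)"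
proof -
  interpret pair_graph G by (rule pair_graph)
  show "finite (pverts G)" "finite (parcs G)" by (rule pair_finite_verts pair_finite_arcs)+
qed

lemma finite_nbrs [simp]: "finite (parcs G `` S)"
  using finite_edges by (rule finite_Image)

lemma card_nbrs:
  assumes "u \<in> pverts G"
  shows "card (parcs G `` {u}) = d"
proof -
  have "out_degree (with_proj G) u = d"
    using good assms by (simp add: good_bi_expander_def bi_expander_def regular_def)
  moreover have "out_arcs (with_proj G) u = Pair u ` (parcs G `` {u})"
    by (auto simp: out_arcs_def)
  ultimately show ?thesis
    by (simp add: out_degree_def card_image inj_on_def)
qed

lemma connected_induct:
  assumes "u \<in> pverts G" "w \<in> pverts G" "P u"
    and "\<And>x y. (x, y) \<in> parcs G \<Longrightarrow> P x \<Longrightarrow> P y"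
  shows "P w"
proof -
  interpret pair_graph G by (rule pair_graph)
  have "u \<rightarrow>\<^sup>*\<^bsub>mk_symmetric (with_proj G)\<^esub> w"
    using conn assms(1,2) by (auto simp: connected_def strongly_connected_def)
  then have "u \<rightarrow>\<^sup>*\<^bsub>with_proj G\<^esub> w"
    using reachable_mk_symmetric_eq[OF pair_sym_arcs] by simp
  then have "(u, w) \<in> (parcs G)\<^sup>*"
    unfolding reachable_def with_proj_simps by (rule rtrancl_on_rtranclI)
  then show ?thesis
    by induction (blast intro: assms)+
qed

lemma verts_eq: "pverts G = V 0 \<union> V 1" and classes_disjoint: "V 0 \<inter> V 1 = {}"
  using good by (auto simp: good_bi_expander_def bi_expander_def color_classes_def)

lemma class_subset: "i \<in> {0, 1} \<Longrightarrow> V i \<subseteq> pverts G"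
  using verts_eq by auto

lemma verts_eq_class: "i \<in> {0, 1} \<Longrightarrow> pverts G = V i \<union> V (1 - i)"
  and class_disjoint: "i \<in> {0, 1} \<Longrightarrow> V i \<inter> V (1 - i) = {}"
  using verts_eq classes_disjoint by auto

lemma finite_class: "i \<in> {0, 1} \<Longrightarrow> finite (V i)"
  using class_subset finite_verts finite_subset by metis

lemma edge_swaps_class:
  assumes "(u, w) \<in> parcs G" "i \<in> {0, 1}"
  shows "u \<in> V i \<longleftrightarrow> w \<in> V (1 - i)"
proof -
  have "\<forall>(u, w) \<in> parcs G. u \<in> V 0 \<longleftrightarrow> w \<in> V 1"
    using good by (auto simp: good_bi_expander_def bi_expander_def color_classes_def)
  then show ?thesis using assms edge_sym by fastforce
qed

lemma nbrs_subset:
  assumes "i \<in> {0, 1}" "S \<subseteq> V i"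
  shows "parcs G `` S \<subseteq> V (1 - i)"
  using assms edge_swaps_class by blast

lemma edge_count_eq_sum:
  assumes "finite S"
  shows "edge_count G S T = (\<Sum>a\<in>S. card (parcs G `` {a} \<inter> T))"
proof -
  have "{(a, b). a \<in> S \<and> b \<in> T \<and> (a, b) \<in> parcs G} = Sigma S (\<lambda>a. parcs G `` {a} \<inter> T)"
    by auto
  then show ?thesis
    using assms by (simp add: edge_count_def)
qed

lemma edge_count_commute: "edge_count G S T = edge_count G T S"
proof -
  have "{(a, b). a \<in> T \<and> b \<in> S \<and> (a, b) \<in> parcs G}
      = prod.swap ` {(a, b). a \<in> S \<and> b \<in> T \<and> (a, b) \<in> parcs G}"
    using edge_sym by force
  then show ?thesis
    by (simp add: edge_count_def card_image)
qed

lemma edge_count_nbrs_subset: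
  assumes "S \<subseteq> pverts G" "parcs G `` S \<subseteq> T"
  shows "edge_count G S T = d * card S"
proof -
  have "edge_count G S T = (\<Sum>a\<in>S. card (parcs G `` {a} \<inter> T))"
    using finite_subset[OF assms(1) finite_verts] by (rule edge_count_eq_sum)
  also have "\<dots> = (\<Sum>a\<in>S. d)"
  proof (intro sum.cong refl)
    fix a assume "a \<in> S"
    then have "parcs G `` {a} \<inter> T = parcs G `` {a}" using assms(2) by auto
    then show "card (parcs G `` {a} \<inter> T) = d" using card_nbrs \<open>a \<in> S\<close> assms(1) by auto
  qed
  finally show ?thesis by simp
qed

lemma d_ge_2: "d \<ge> 2"
  using good by (simp add: good_bi_expander_def)

lemma card_class: "i \<in> {0, 1} \<Longrightarrow> card (V i) = n"
proof -
  have "edge_count G (V 0) (V 1) = d * card (V 0)" "edge_count G (V 1) (V 0) = d * card (V 1)"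
    using edge_count_nbrs_subset nbrs_subset[of 0 "V 0"] nbrs_subset[of 1 "V 1"] class_subset
    by auto
  then have "card (V 0) = card (V 1)"
    using edge_count_commute[of "V 0" "V 1"] d_ge_2 by simp
  moreover have "card (V 0) + card (V 1) = 2 * n"
    using good verts_eq classes_disjoint finite_class[of 0] finite_class[of 1]
    by (simp add: good_bi_expander_def bi_expander_def card_Un_disjoint)
  ultimately show "i \<in> {0, 1} \<Longrightarrow> card (V i) = n" by auto
qed

lemma verts_nonempty: "pverts G \<noteq> {}"
  using conn by (auto simp: connected_def strongly_connected_def)

lemma n_pos: "n > 0"
  using verts_nonempty verts_eq card_class[of 0] card_class[of 1] finite_class[of 0] finite_class[of 1]
  by (auto simp: card_gt_0_iff)

lemma expander:
  assumes "i \<in> {0, 1}" "S \<subseteq> V i" "T \<subseteq> V (1 - i)"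
  shows "\<bar>real (edge_count G S T) - real d / real n * real (card S) * real (card T)\<bar>
          \<le> lam * sqrt (real (card S) * real (card T))"
proof -
  have *: "\<bar>real (edge_count G S T) - real d / real n * real (card S) * real (card T)\<bar>
          \<le> lam * sqrt (real (card S) * real (card T))" if "S \<subseteq> V 0" "T \<subseteq> V 1" for S T
    using good that by (auto simp: good_bi_expander_def bi_expander_def)
  show ?thesis
    using *[of S T] *[of T S] assms edge_count_commute[of S T]
    by (auto simp: algebra_simps)
qed

lemma lam_nonneg: "lam \<ge> 0"
proof -
  have "V 0 \<noteq> {}" "V 1 \<noteq> {}"
    using card_class[of 0] card_class[of 1] n_pos by auto
  then obtain a b where "a \<in> V 0" "b \<in> V 1" by blast
  then show ?thesis
    using expander[of 0 "{a}" "{b}"] by (simp add: order.trans[OF abs_ge_zero])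
qed

lemma ln_d_ge: "ln (real d) \<ge> 2 / 3"
proof -
  have "ln 2 \<le> ln (real d)" using d_ge_2 by (subst ln_le_cancel_iff) auto
  then show ?thesis using ln2_ge_two_thirds by linarith
qed

lemma lam_le: "300 * (lam * ln (real d)) \<le> real d"
  using good ln_d_ge by (simp add: good_bi_expander_def field_simps)

text \<open>
  At most \<open>2 * (lam * n / d)\<close> vertices of the almost constant class are exceptional, so exceptional
  sets are far from filling a color class.
\<close>

lemma exceptional_lt: "200 * (lam * real n / real d) \<le> real n"
proof -
  have "lam * (2 / 3) \<le> lam * ln (real d)"
    using ln_d_ge lam_nonneg by (rule mult_left_mono)
  then have "200 * lam \<le> real d" using lam_le by linarith
  then show ?thesis using d_ge_2 n_pos by (simp add: field_simps)
qed

lemma card_small_of_no_edges: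
  assumes "i \<in> {0, 1}" "S \<subseteq> V i" "T \<subseteq> V (1 - i)"
    and "\<And>a b. a \<in> S \<Longrightarrow> b \<in> T \<Longrightarrow> (a, b) \<notin> parcs G"
  shows "real (card S) \<le> lam * real n / real d \<or> real (card T) \<le> lam * real n / real d"
proof (rule ccontr)
  let ?m = "lam * real n / real d" and ?q = "sqrt (real (card S) * real (card T))"
  assume "\<not> ?thesis"
  then have gt: "real (card S) > ?m" "real (card T) > ?m" by auto
  have m: "?m \<ge> 0" using lam_nonneg by simp
  have "{(a, b). a \<in> S \<and> b \<in> T \<and> (a, b) \<in> parcs G} = {}" using assms(4) by auto
  then have "edge_count G S T = 0" by (simp only: edge_count_def card.empty)
  then have "real d / real n * ?q * ?q \<le> lam * ?q"
    using expander[OF assms(1-3)] by (simp add: mult.assoc)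
  moreover have "?m * ?m < real (card S) * real (card T)"
    using gt m by (intro mult_strict_mono') auto
  then have q: "?q > ?m"
    using m by (simp add: real_less_rsqrt power2_eq_square)
  moreover have "?q > 0" using q m by linarith
  ultimately have "real d / real n * ?q \<le> lam"
    by (metis mult_le_cancel_right_pos)
  then have "?q \<le> ?m"
    using d_ge_2 n_pos by (simp add: field_simps)
  with q show False by simp
qed

text \<open>
  All \<open>d |S|\<close> edges leaving \<open>S\<close> end in its neighborhood. If the neighborhood were smaller than
  claimed, the expected number of edges would account for at most half of them, and the allowed
  discrepancy for less than half.
\<close>

lemma small_set_expands:
  assumes "i \<in> {0, 1}" "S \<subseteq> V i" and small: "real (card S) \<le> 2 * lam * real n / real d"
  shows "75 * ln (real d) * real (card S) \<le> real (card (parcs G `` S))"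
proof (rule ccontr)
  define s \<tau> L where "s = real (card S)" and "\<tau> = real (card (parcs G `` S))" and "L = ln (real d)"
  assume "\<not> ?thesis"
  then have \<tau>: "\<tau> < 75 * L * s" by (simp add: s_def \<tau>_def L_def)
  have L: "L \<ge> 2 / 3" using ln_d_ge by (simp add: L_def)
  have s: "s > 0"
  proof -
    have "0 < 75 * L * s" using \<tau> by (simp add: \<tau>_def)
    then show ?thesis using L by (simp add: zero_less_mult_iff)
  qed
  have "edge_count G S (parcs G `` S) = d * card S"
    by (rule edge_count_nbrs_subset[OF order_trans[OF assms(2) class_subset[OF assms(1)]] order_refl])
  then have 1: "real d * s \<le> real d / real n * s * \<tau> + lam * sqrt (s * \<tau>)"
    using expander[OF assms(1,2) nbrs_subset[OF assms(1,2)]] by (simp add: s_def \<tau>_def)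
  have dn: "0 < real d" "0 < real n" using d_ge_2 n_pos by auto
  have lamL: "300 * (lam * L) * s \<le> real d * s"
    using lam_le s by (intro mult_right_mono) (auto simp: L_def)
  have "s * \<tau> \<le> (2 * lam * real n / real d) * (75 * L * s)"
    using small \<tau> s lam_nonneg dn by (intro mult_mono) (auto simp: s_def \<tau>_def)
  then have "real d / real n * (s * \<tau>) \<le> real d / real n * ((2 * lam * real n / real d) * (75 * L * s))"
    using dn by (intro mult_left_mono) auto
  also have "\<dots> = 300 * (lam * L) * s / 2"
    using dn by simp
  finally have 2: "real d / real n * s * \<tau> \<le> real d * s / 2"
    using lamL by (simp only: mult.assoc)
  have "s * \<tau> < (75 * L * 1) * (s * s)"
    using mult_strict_left_mono[OF \<tau> s] by (simp only: mult_ac mult_1_right)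
  also have "\<dots> < (75 * L * (300 * L)) * (s * s)"
    using L s by (intro mult_strict_right_mono mult_strict_left_mono) auto
  also have "\<dots> = (150 * L * s)\<^sup>2" by (simp add: power2_eq_square)
  finally have sq: "sqrt (s * \<tau>) < 150 * L * s"
    using L s by (intro real_less_lsqrt mult_nonneg_nonneg) auto
  have "lam * sqrt (s * \<tau>) < real d * s / 2"
  proof (cases "lam = 0")
    case True
    then show ?thesis using s dn by simp
  next
    case False
    then have "lam * sqrt (s * \<tau>) < lam * (150 * L * s)"
      using sq lam_nonneg by (intro mult_strict_left_mono) auto
    also have "\<dots> = 300 * (lam * L) * s / 2" by simp
    finally show ?thesis using lamL by linarith
  qed
  with 1 2 show False by linarith
qed

section \<open>Existence and uniqueness of the phase\<close>

definition unit_steps :: "('a \<Rightarrow> int) \<Rightarrow> bool" where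
  "unit_steps f \<longleftrightarrow> (\<forall>(u, w) \<in> parcs G. \<bar>f u - f w\<bar> = 1)"

lemma unit_stepsD: "unit_steps f \<Longrightarrow> (u, w) \<in> parcs G \<Longrightarrow> \<bar>f u - f w\<bar> = 1"
  by (auto simp: unit_steps_def)

lemma even_diff_of_same_class:
  assumes "unit_steps f" "i \<in> {0, 1}" "u \<in> V i" "w \<in> V i"
  shows "even (f u - f w)"
proof -
  have "even (f u - f w) \<longleftrightarrow> w \<in> V i"
  proof (rule connected_induct[where P = "\<lambda>w. even (f u - f w) \<longleftrightarrow> w \<in> V i" and u = u])
    show "u \<in> pverts G" "w \<in> pverts G" using assms class_subset by auto
    show "even (f u - f u) \<longleftrightarrow> u \<in> V i" using assms by simp
  next
    fix x y assume xy: "(x, y) \<in> parcs G" and IH: "even (f u - f x) \<longleftrightarrow> x \<in> V i"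
    have "x \<in> V i \<longleftrightarrow> y \<notin> V i"
      using edge_swaps_class[OF xy assms(2)] edge_in_verts[OF xy]
        verts_eq_class[OF assms(2)] class_disjoint[OF assms(2)] by blast
    moreover have "even (f u - f y) \<longleftrightarrow> odd (f u - f x)"
      using unit_stepsD[OF assms(1) xy] by presburger
    ultimately show "even (f u - f y) \<longleftrightarrow> y \<in> V i" using IH by blast
  qed
  then show ?thesis using assms(4) by simp
qed

text \<open>
  For two different values, the two exceptional sets would cover the class.
\<close>

lemma almost_constant_unique:
  assumes "i \<in> {0, 1}" "almost_constant V n d lam f i k" "almost_constant V n d lam f i l"
  shows "k = l"
proof (rule ccontr)
  assume "k \<noteq> l"
  then have "V i = {w \<in> V i. f w \<noteq> k} \<union> {w \<in> V i. f w \<noteq> l}" by auto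
  then have "card (V i) \<le> card {w \<in> V i. f w \<noteq> k} + card {w \<in> V i. f w \<noteq> l}"
    using card_Un_le by metis
  then have "real n \<le> 4 * (lam * real n / real d)"
    using assms(2,3) card_class[OF assms(1)] by (simp add: almost_constant_def)
  then show False using exceptional_lt n_pos by simp
qed

lemma almost_constant_attained:
  assumes "i \<in> {0, 1}" "almost_constant V n d lam f i k"
  shows "\<exists>w\<in>V i. f w = k"
proof (rule ccontr)
  assume "\<not> ?thesis"
  then have "{w \<in> V i. f w \<noteq> k} = V i" by auto
  then have "real n \<le> 2 * (lam * real n / real d)"
    using assms card_class[OF assms(1)] by (simp add: almost_constant_def)
  then show False using exceptional_lt n_pos by simp
qed

text \<open>
  Take the lowest level \<open>a\<close> at which one of the classes, \<open>V i\<close>, has more than \<open>lam * n / d\<close> vertices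
  of height at most \<open>a\<close>. The other class \<open>V j\<close> then has few vertices above \<open>a + 1\<close>, since none of
  them is adjacent to a low vertex of \<open>V i\<close>, and by minimality it has few vertices below \<open>a\<close>. What
  remains of \<open>V j\<close> has height \<open>a\<close> or \<open>a + 1\<close>, and parity leaves only one of the two.
\<close>

lemma exists_almost_constant:
  assumes "unit_steps f"
  shows "\<exists>i\<in>{0, 1}. \<exists>k. almost_constant V n d lam f i k"
proof -
  define m where "m = lam * real n / real d"
  have m: "0 \<le> m" "200 * m \<le> real n"
    using lam_nonneg exceptional_lt by (auto simp: m_def)
  define below where "below j a = {w \<in> V j. f w \<le> a}" for j a
  define A where "A = {a \<in> f ` pverts G. \<exists>j\<in>{0, 1}. real (card (below j a)) > m}"
  have finA: "finite A" using finite_verts by (simp add: A_def)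
  have "Max (f ` pverts G) \<in> A"
  proof -
    have "below 0 (Max (f ` pverts G)) = V 0"
      using finite_verts class_subset[of 0] by (auto simp: below_def)
    then have "real (card (below 0 (Max (f ` pverts G)))) > m"
      using card_class[of 0] m n_pos by auto
    then show ?thesis
      using finite_verts verts_nonempty by (auto simp: A_def)
  qed
  define a where "a = Min A"
  have "a \<in> A" unfolding a_def using finA \<open>Max (f ` pverts G) \<in> A\<close> by (intro Min_in) auto
  then obtain i where i: "i \<in> {0, 1}" "real (card (below i a)) > m" by (auto simp: A_def)
  define j where "j = 1 - i"
  have j: "j \<in> {0, 1}" "i = 1 - j" using i by (auto simp: j_def)
  have low: "real (card (below j (a - 1))) \<le> m"
  proof (rule ccontr)
    assume big: "\<not> ?thesis"
    define b where "b = Max (f ` below j (a - 1))"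
    have fin: "finite (below j (a - 1))" using finite_class[OF j(1)] by (simp add: below_def)
    have ne: "below j (a - 1) \<noteq> {}" using big m by auto
    then have b: "b \<in> f ` below j (a - 1)" unfolding b_def using fin by (intro Max_in) auto
    have "below j b = below j (a - 1)"
    proof
      show "below j b \<subseteq> below j (a - 1)" using b by (auto simp: below_def)
      have "f w \<le> b" if "w \<in> below j (a - 1)" for w
        unfolding b_def using fin that by simp
      then show "below j (a - 1) \<subseteq> below j b" by (auto simp: below_def)
    qed
    moreover have "b \<in> f ` pverts G" using b class_subset[OF j(1)] by (auto simp: below_def)
    ultimately have "b \<in> A" using big j(1) by (auto simp: A_def)
    then have "a \<le> b" using finA by (simp add: a_def)
    then show False using b by (auto simp: below_def)
  qed
  have high: "real (card {w \<in> V j. f w \<ge> a + 2}) \<le> m"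
  proof -
    have "(u, w) \<notin> parcs G" if "u \<in> below i a" "w \<in> {w \<in> V j. f w \<ge> a + 2}" for u w
      using that unit_stepsD[OF assms, of u w] by (auto simp: below_def)
    then have "real (card (below i a)) \<le> m \<or> real (card {w \<in> V j. f w \<ge> a + 2}) \<le> m"
      unfolding m_def using i(1)
      by (intro card_small_of_no_edges[of i]) (auto simp: below_def j_def)
    then show ?thesis using i(2) by linarith
  qed
  have "card (V j) > 0" using card_class[OF j(1)] n_pos by simp
  then obtain w\<^sub>0 where w\<^sub>0: "w\<^sub>0 \<in> V j" by (auto simp: card_gt_0_iff)
  \<comment> \<open>The parity of \<open>f\<close> on \<open>V j\<close> selects one of the two central levels.\<close>
  define k where "k = (if even (f w\<^sub>0 - a) then a else a + 1)"
  have "{w \<in> V j. f w \<noteq> k} \<subseteq> below j (a - 1) \<union> {w \<in> V j. f w \<ge> a + 2}"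
  proof
    fix w assume w: "w \<in> {w \<in> V j. f w \<noteq> k}"
    then have "even (f w\<^sub>0 - f w)"
      using even_diff_of_same_class[OF assms j(1) w\<^sub>0] by auto
    then have "f w \<noteq> a \<and> f w \<noteq> a + 1"
      using w by (auto simp: k_def split: if_splits)
    then show "w \<in> below j (a - 1) \<union> {w \<in> V j. f w \<ge> a + 2}"
      using w by (auto simp: below_def)
  qed
  then have "card {w \<in> V j. f w \<noteq> k} \<le> card (below j (a - 1) \<union> {w \<in> V j. f w \<ge> a + 2})"
    using finite_class[OF j(1)] by (intro card_mono) (auto simp: below_def)
  also have "\<dots> \<le> card (below j (a - 1)) + card {w \<in> V j. f w \<ge> a + 2}"
    by (rule card_Un_le)
  finally have "real (card {w \<in> V j. f w \<noteq> k}) \<le> 2 * m"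
    using low high by linarith
  then have "almost_constant V n d lam f j k"
    by (simp add: almost_constant_def m_def)
  then show ?thesis using j(1) by blast
qed

lemma phase_almost_constant:
  assumes "unit_steps f"
  shows "phase_class V n d lam f \<in> {0, 1}"
    and "almost_constant V n d lam f (phase_class V n d lam f) (phase V n d lam f)"
proof -
  obtain i where "i \<in> {0, 1} \<and> (\<exists>k. almost_constant V n d lam f i k)"
    using exists_almost_constant[OF assms] by blast
  then have c: "phase_class V n d lam f \<in> {0, 1} \<and>
      (\<exists>k. almost_constant V n d lam f (phase_class V n d lam f) k)"
    unfolding phase_class_def by (rule LeastI)
  then obtain k where k: "almost_constant V n d lam f (phase_class V n d lam f) k" by blast
  have "phase V n d lam f = k"
    unfolding phase_def using k almost_constant_unique c by (intro Least_equality) (blast, metis order_refl)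
  then show "phase_class V n d lam f \<in> {0, 1}"
    "almost_constant V n d lam f (phase_class V n d lam f) (phase V n d lam f)"
    using c k by auto
qed

section \<open>Heights above the phase\<close>

text \<open>
  Height functions measured from the phase instead of from the value at \<open>v\<^sub>0\<close>. Flattening changes
  values at and around \<open>v\<^sub>0\<close>, so it respects this normalization but not the one in \<^const>\<open>Hom\<close>.
\<close>

definition heights :: "nat \<Rightarrow> ('a \<Rightarrow> int) set" where
  "heights i = {h \<in> pverts G \<rightarrow>\<^sub>E UNIV. unit_steps h \<and> almost_constant V n d lam h i 0}"

lemma heights_even:
  assumes "i \<in> {0, 1}" "h \<in> heights i" "w \<in> V i"
  shows "even (h w)"
proof -
  obtain w\<^sub>0 where "w\<^sub>0 \<in> V i" "h w\<^sub>0 = 0"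
    using almost_constant_attained assms(1,2) unfolding heights_def by blast
  then show ?thesis
    using even_diff_of_same_class[OF _ assms(1) assms(3), of h w\<^sub>0] assms(2) by (simp add: heights_def)
qed

text \<open>
  Connectedness bounds \<open>f w\<close> by a number that depends on \<open>w\<close> only.
\<close>

lemma finite_Hom:
  assumes "v\<^sub>0 \<in> pverts G"
  shows "finite (Hom G v\<^sub>0)"
proof -
  have "\<exists>l. \<forall>f\<in>Hom G v\<^sub>0. \<bar>f w\<bar> \<le> l" if "w \<in> pverts G" for w
  proof (rule connected_induct[where P = "\<lambda>w. \<exists>l. \<forall>f\<in>Hom G v\<^sub>0. \<bar>f w\<bar> \<le> l" and u = v\<^sub>0])
    show "\<exists>l. \<forall>f\<in>Hom G v\<^sub>0. \<bar>f v\<^sub>0\<bar> \<le> l"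
      by (intro exI[of _ 0]) (simp add: Hom_def)
    fix x y assume xy: "(x, y) \<in> parcs G" and "\<exists>l. \<forall>f\<in>Hom G v\<^sub>0. \<bar>f x\<bar> \<le> l"
    then obtain l where l: "\<And>f. f \<in> Hom G v\<^sub>0 \<Longrightarrow> \<bar>f x\<bar> \<le> l" by blast
    have "\<bar>f y\<bar> \<le> l + 1" if f: "f \<in> Hom G v\<^sub>0" for f
    proof -
      have "\<bar>f x - f y\<bar> = 1" using f xy by (auto simp: Hom_def)
      then show ?thesis using l[OF f] by linarith
    qed
    then show "\<exists>l. \<forall>f\<in>Hom G v\<^sub>0. \<bar>f y\<bar> \<le> l" by blast
  qed (use assms that in auto)
  then obtain l where l: "\<And>w f. w \<in> pverts G \<Longrightarrow> f \<in> Hom G v\<^sub>0 \<Longrightarrow> \<bar>f w\<bar> \<le> l w"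
    by metis
  have "Hom G v\<^sub>0 \<subseteq> (\<Pi>\<^sub>E w\<in>pverts G. {- l w..l w})"
  proof
    fix f assume f: "f \<in> Hom G v\<^sub>0"
    then have "f \<in> pverts G \<rightarrow>\<^sub>E UNIV" by (simp add: Hom_def)
    moreover have "f w \<in> {- l w..l w}" if "w \<in> pverts G" for w
      using l[OF that f] by (simp add: abs_le_iff)
    ultimately show "f \<in> (\<Pi>\<^sub>E w\<in>pverts G. {- l w..l w})" by (auto simp: PiE_iff)
  qed
  then show ?thesis
    by (rule finite_subset) (intro finite_PiE finite_verts, simp)
qed

lemma Hom_nonempty:
  assumes "v\<^sub>0 \<in> V 0"
  shows "Hom G v\<^sub>0 \<noteq> {}"
proof -
  define f :: "'a \<Rightarrow> int" where "f = restrict (\<lambda>w. if w \<in> V 0 then 0 else 1) (pverts G)"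
  have "\<bar>f u - f w\<bar> = 1" if uw: "(u, w) \<in> parcs G" for u w
    using edge_swaps_class[OF uw, of 0] edge_in_verts[OF uw] verts_eq classes_disjoint
    by (auto simp: f_def)
  moreover have "f v\<^sub>0 = 0" "f \<in> pverts G \<rightarrow>\<^sub>E UNIV"
    using assms class_subset[of 0] by (auto simp: f_def)
  ultimately show ?thesis unfolding Hom_def by blast
qed

text \<open>
  Subtracting the value at \<open>v\<^sub>0\<close> loses nothing, because level zero can be recognized afterwards: it is
  the only value taken on almost all of \<open>V i\<close>.
\<close>

lemma heights_into_Hom:
  assumes i: "i \<in> {0, 1}" and v\<^sub>0: "v\<^sub>0 \<in> pverts G"
  shows "finite (heights i) \<and> card (heights i) \<le> card (Hom G v\<^sub>0)"
proof -
  define pin where "pin h = restrict (\<lambda>w. h w - h v\<^sub>0) (pverts G)" for h :: "'a \<Rightarrow> int"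
  have "inj_on pin (heights i)"
  proof (rule inj_onI)
    fix h h' assume h: "h \<in> heights i" and h': "h' \<in> heights i" and eq: "pin h = pin h'"
    define c where "c = h' v\<^sub>0 - h v\<^sub>0"
    have shift: "h' w = h w + c" if "w \<in> pverts G" for w
    proof -
      have "pin h w = pin h' w" using eq by simp
      then show ?thesis using that by (simp add: pin_def c_def)
    qed
    have "almost_constant V n d lam h' i c"
    proof -
      have "{w \<in> V i. h' w \<noteq> c} = {w \<in> V i. h w \<noteq> 0}"
      proof (intro Collect_cong conj_cong refl)
        fix w assume "w \<in> V i"
        then have "h' w = h w + c" using shift class_subset[OF i] by blast
        then show "(h' w \<noteq> c) = (h w \<noteq> 0)" by simp
      qed
      then show ?thesis using h by (simp add: heights_def almost_constant_def)
    qed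
    then have "c = 0"
      using h' almost_constant_unique[OF i] by (simp add: heights_def)
    then show "h = h'"
      using shift h h' unfolding heights_def by (intro PiE_ext[of h "pverts G" _ h']) auto
  qed
  moreover have "pin ` heights i \<subseteq> Hom G v\<^sub>0"
    using v\<^sub>0 by (auto simp: pin_def Hom_def heights_def unit_steps_def dest: edge_in_verts)
  ultimately show ?thesis
    using finite_Hom[OF v\<^sub>0] card_inj_on_le inj_on_finite by blast
qed

lemma finite_heights: "i \<in> {0, 1} \<Longrightarrow> finite (heights i)"
  using heights_into_Hom verts_nonempty by blast

section \<open>The excursion around a high vertex\<close>

text \<open>
  Heights are even on \<open>V i\<close>, so \<open>2\<close> is the least positive one.
\<close>

definition high :: "nat \<Rightarrow> ('a \<Rightarrow> int) \<Rightarrow> 'a set" where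
  "high i h = {w \<in> V i. 2 \<le> h w}"

definition excursion :: "nat \<Rightarrow> ('a \<Rightarrow> int) \<Rightarrow> 'a \<Rightarrow> 'a set" where
  "excursion i h x = {w. (x, w) \<in> ((parcs G O parcs G) \<inter> high i h \<times> high i h)\<^sup>*}"

context
  fixes i h x
  assumes i: "i \<in> {0, 1}" and h: "h \<in> heights i" and x: "x \<in> high i h"
begin

private abbreviation "S \<equiv> excursion i h x"

lemma root_in_excursion: "x \<in> S"
  by (simp add: excursion_def)

lemma excursion_subset_high: "S \<subseteq> high i h"
proof
  fix w assume "w \<in> S"
  then have "(x, w) \<in> ((parcs G O parcs G) \<inter> high i h \<times> high i h)\<^sup>*" by (simp add: excursion_def)
  then show "w \<in> high i h" by induction (use x in auto)
qed

lemma excursion_subset_class: "S \<subseteq> V i"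
  using excursion_subset_high by (auto simp: high_def)

lemma finite_excursion: "finite S"
  using excursion_subset_class finite_class[OF i] finite_subset by blast

text \<open>
  Such a vertex is one two-step move away from the excursion, so it would belong to it if its height
  were at least \<open>2\<close>; it is also at least \<open>0\<close>, and even.
\<close>

lemma height_beyond_excursion:
  assumes "u \<in> parcs G `` S" "(u, z) \<in> parcs G" "z \<notin> S"
  shows "h z = 0"
proof -
  obtain y where y: "y \<in> S" "(y, u) \<in> parcs G" using assms(1) by auto
  have steps: "\<bar>h y - h u\<bar> = 1" "\<bar>h u - h z\<bar> = 1"
    using y assms(2) h by (auto simp: heights_def unit_steps_def)
  have yh: "y \<in> high i h" using y excursion_subset_high by auto
  have "z \<in> V i"
    using y assms(2) excursion_subset_class edge_swaps_class[OF _ i] edge_sym by blast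
  moreover have "z \<notin> high i h"
  proof
    assume "z \<in> high i h"
    then have "(y, z) \<in> (parcs G O parcs G) \<inter> high i h \<times> high i h"
      using y(2) assms(2) yh by auto
    then have "z \<in> S"
      using y(1) unfolding excursion_def by (simp add: rtrancl_into_rtrancl)
    then show False using assms(3) by simp
  qed
  ultimately have "h z < 2" "even (h z)"
    using heights_even[OF i h] by (auto simp: high_def)
  moreover have "h z \<ge> 0" using yh steps by (auto simp: high_def)
  ultimately show ?thesis by (cases "h z = 1") auto
qed

lemma height_at_rim:
  assumes "u \<in> parcs G `` S" "\<not> parcs G `` {u} \<subseteq> S"
  shows "h u = 1"
proof -
  obtain z where z: "(u, z) \<in> parcs G" "z \<notin> S" using assms(2) by auto
  obtain y where y: "y \<in> S" "(y, u) \<in> parcs G" using assms(1) by auto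
  have "h z = 0" using height_beyond_excursion assms(1) z by blast
  moreover have "\<bar>h u - h z\<bar> = 1" "\<bar>h y - h u\<bar> = 1" "h y \<ge> 2"
    using z y excursion_subset_high h by (auto simp: heights_def unit_steps_def high_def)
  ultimately show ?thesis by linarith
qed

lemma card_excursion_le: "real (card S) \<le> 2 * lam * real n / real d"
proof -
  have "card S \<le> card {w \<in> V i. h w \<noteq> 0}"
    using excursion_subset_high finite_class[OF i] by (intro card_mono) (auto simp: high_def)
  then show ?thesis
    using h by (auto simp: heights_def almost_constant_def)
qed

text \<open>
  If all heights on the excursion were \<open>4\<close> or more, no neighbor could be at height \<open>1\<close>, the
  excursion would have no rim, and by connectedness it would fill the whole class. The height \<open>2\<close> that
  is attained serves to recover the absolute heights on an excursion from the relative ones.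
\<close>

lemma excursion_reaches_2: "\<exists>y\<in>S. h y = 2"
proof (rule ccontr)
  assume no2: "\<not> ?thesis"
  have inner: "z \<in> S" if uz: "u \<in> parcs G `` S" "(u, z) \<in> parcs G" for u z
  proof (rule ccontr)
    assume "z \<notin> S"
    obtain y where y: "y \<in> S" "(y, u) \<in> parcs G" using uz(1) by auto
    have "h u = 1" using height_at_rim[OF uz(1)] uz(2) \<open>z \<notin> S\<close> by auto
    moreover have "\<bar>h y - h u\<bar> = 1" "h y \<ge> 2"
      using y excursion_subset_high h by (auto simp: heights_def unit_steps_def high_def)
    ultimately show False using no2 y(1) by auto
  qed
  have "w \<in> S \<union> parcs G `` S" if "w \<in> pverts G" for w
  proof (rule connected_induct[where P = "\<lambda>w. w \<in> S \<union> parcs G `` S" and u = x])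
    show "x \<in> pverts G" using x class_subset[OF i] by (auto simp: high_def)
    show "w \<in> pverts G" by (rule that)
    show "x \<in> S \<union> parcs G `` S" using root_in_excursion by simp
  qed (use inner in blast)
  then have "V i \<subseteq> S"
    using class_subset[OF i] nbrs_subset[OF i excursion_subset_class] class_disjoint[OF i] by blast
  then have "n \<le> card S"
    using card_mono[OF finite_excursion] card_class[OF i] by metis
  then have "real n \<le> 2 * (lam * real n / real d)"
    using card_excursion_le by simp
  then show False using exceptional_lt n_pos by simp
qed

lemma excursion_absorbs_positive:
  assumes "u \<in> S \<union> parcs G `` S" "(u, z) \<in> parcs G" "h z \<ge> 1"
  shows "z \<in> S \<union> parcs G `` S"
  using assms height_beyond_excursion[of u z] by auto

end

lemma excursion_absorbs_walk:
  assumes i: "i \<in> {0, 1}" and h: "h \<in> heights i" and x: "x \<in> high i h"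
    and "pcas u p w" "set p \<subseteq> parcs G" "u \<in> excursion i h x \<union> parcs G `` excursion i h x"
    and "h u > int (length p)"
  shows "w \<in> excursion i h x \<union> parcs G `` excursion i h x"
  using assms(4-7)
proof (induction p arbitrary: u)
  case (Cons e p)
  obtain z where e: "e = (u, z)" using Cons.prems(1) by (cases e) auto
  have uz: "(u, z) \<in> parcs G" using Cons.prems(2) e by simp
  then have "\<bar>h u - h z\<bar> = 1" using h by (auto simp: heights_def unit_steps_def)
  then have hz: "h z > int (length p)" using Cons.prems(4) by simp
  then have "h z \<ge> 1" by linarith
  then have "z \<in> excursion i h x \<union> parcs G `` excursion i h x"
    using excursion_absorbs_positive[OF i h x Cons.prems(3) uz] by blast
  then show ?case
    using Cons.IH[of z] Cons.prems(1,2) e hz by simp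
qed simp

lemma graph_ball_walk:
  assumes "w \<in> graph_ball G v t"
  obtains p where "pcas v p w" "set p \<subseteq> parcs G" "length p \<le> t"
proof -
  interpret pair_graph G by (rule pair_graph)
  have "\<mu> (\<lambda>_. 1) v w \<le> ereal (real t)" using assms by (simp add: graph_ball_def)
  also have "\<dots> < ereal (real t + 1)" by simp
  finally obtain p where p: "awalk v p w" "awalk_cost (\<lambda>_. 1) p < real t + 1"
    unfolding \<mu>_def by (auto simp: INF_less_iff)
  have "awalk_cost (\<lambda>_. 1) p = real (length p)"
    by (simp add: awalk_cost_def sum_list_triv)
  then have "length p \<le> t" using p(2) by linarith
  then show thesis using p(1) that by (auto simp: awalk_def)
qed

lemma graph_ball_subset_excursion:
  assumes "i \<in> {0, 1}" "h \<in> heights i" "x \<in> high i h"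
    and "v \<in> excursion i h x \<union> parcs G `` excursion i h x" "h v > int t"
  shows "graph_ball G v t \<subseteq> excursion i h x \<union> parcs G `` excursion i h x"
proof
  fix w assume "w \<in> graph_ball G v t"
  then obtain p where p: "pcas v p w" "set p \<subseteq> parcs G" "length p \<le> t"
    by (rule graph_ball_walk)
  then show "w \<in> excursion i h x \<union> parcs G `` excursion i h x"
    using excursion_absorbs_walk[OF assms(1-3) p(1,2) assms(4)] assms(5) by linarith
qed

section \<open>Profiles of excursions\<close>

text \<open>
  Heights are recorded relative to the root so that a profile contains the fixed point \<open>(x, 0)\<close>. This
  keeps the unbounded height of the root out of the count.
\<close>

definition profile :: "nat \<Rightarrow> ('a \<Rightarrow> int) \<Rightarrow> 'a \<Rightarrow> ('a \<times> int) set" where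
  "profile i h x = (\<lambda>w. (w, h w - h x)) ` excursion i h x"

text \<open>
  A move through a common neighbor changes the height by \<open>-2\<close>, \<open>0\<close> or \<open>2\<close>, so recording heights
  along with vertices costs a factor of only \<open>3\<close> in the degree.
\<close>

definition climbs :: "('a \<times> int) rel" where
  "climbs = {((y, a), (z, b)). (y, z) \<in> parcs G O parcs G \<and> b - a \<in> {- 2, 0, 2}}"

lemma sym_climbs: "sym climbs"
  using edge_sym by (fastforce simp: climbs_def intro: symI)

lemma card_nbrs_of_set: "finite A \<Longrightarrow> card (parcs G `` A) \<le> card A * d"
proof -
  assume "finite A"
  have "parcs G `` A = (\<Union>a\<in>A. parcs G `` {a})" by auto
  then have "card (parcs G `` A) \<le> (\<Sum>a\<in>A. card (parcs G `` {a}))"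
    using card_UN_le[OF \<open>finite A\<close>] by metis
  also have "\<dots> \<le> (\<Sum>a\<in>A. d)"
  proof (rule sum_mono)
    fix a
    show "card (parcs G `` {a}) \<le> d"
    proof (cases "a \<in> pverts G")
      case False
      then have "parcs G `` {a} = {}" using edge_in_verts by auto
      then show ?thesis by simp
    qed (simp add: card_nbrs)
  qed
  finally show ?thesis by simp
qed

lemma climbs_degree: "finite (climbs `` {p}) \<and> card (climbs `` {p}) \<le> 3 * d\<^sup>2"
proof -
  obtain y a where p: "p = (y, a)" by force
  let ?R = "parcs G `` (parcs G `` {y}) \<times> {a - 2, a, a + 2}"
  have sub: "climbs `` {p} \<subseteq> ?R" by (auto simp: climbs_def p)
  have fin: "finite ?R" by simp
  have "card (parcs G `` (parcs G `` {y})) \<le> card (parcs G `` {y}) * d"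
    by (rule card_nbrs_of_set) simp
  also have "\<dots> \<le> d * d" using card_nbrs_of_set[of "{y}"] by simp
  finally have "card (parcs G `` (parcs G `` {y})) \<le> d\<^sup>2" by (simp add: power2_eq_square)
  moreover have "card {a - 2, a, a + 2} = 3" by simp
  ultimately have "card ?R \<le> 3 * d\<^sup>2" by (simp add: card_cartesian_product)
  then show ?thesis
    using card_mono[OF fin sub] finite_subset[OF sub fin] by linarith
qed

lemma profile_is_trace:
  assumes "i \<in> {0, 1}" "h \<in> heights i" "x \<in> high i h"
  shows "profile i h x \<in> traces climbs (2 * (card (excursion i h x) - 1)) (x, 0)"
proof -
  let ?S = "excursion i h x" and ?P = "profile i h x"
  note S = root_in_excursion[OF assms] finite_excursion[OF assms]
  have steps: "unit_steps h" using assms(2) by (simp add: heights_def)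
  have "?P \<in> traces climbs (2 * (card ?P - 1)) (x, 0)"
  proof (rule connected_set_is_trace)
    show "finite ?P" using S by (simp add: profile_def)
    show "(x, 0) \<in> ?P" using S by (force simp: profile_def)
    show "sym climbs" by (rule sym_climbs)
  next
    fix p assume "p \<in> ?P"
    then obtain w where p: "p = (w, h w - h x)" and w: "w \<in> ?S" by (auto simp: profile_def)
    from w have "(x, w) \<in> ((parcs G O parcs G) \<inter> high i h \<times> high i h)\<^sup>*"
      by (simp add: excursion_def)
    then have "((x, 0), (w, h w - h x)) \<in> (climbs \<inter> ?P \<times> ?P)\<^sup>*"
    proof induction
      case base
      then show ?case by simp
    next
      case (step y z)
      then have yz: "y \<in> ?S" "z \<in> ?S"
        unfolding excursion_def mem_Collect_eq by (blast, blast intro: rtrancl_into_rtrancl)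
      obtain u where "(y, u) \<in> parcs G" "(u, z) \<in> parcs G" using step(2) by auto
      then have "\<bar>h y - h u\<bar> = 1" "\<bar>h u - h z\<bar> = 1" using unit_stepsD[OF steps] by blast+
      then have "(h z - h x) - (h y - h x) \<in> {- 2, 0, 2}" by auto
      then have "((y, h y - h x), (z, h z - h x)) \<in> climbs \<inter> ?P \<times> ?P"
        using step(2) yz by (auto simp: climbs_def profile_def)
      then show ?case using step.IH by (rule rtrancl_into_rtrancl[rotated])
    qed
    then show "((x, 0), p) \<in> (climbs \<inter> ?P \<times> ?P)\<^sup>*" by (simp add: p)
  qed
  moreover have "card ?P = card ?S"
    unfolding profile_def by (intro card_image inj_onI) simp
  ultimately show ?thesis by simp
qed

section \<open>Flattening an excursion\<close>

text \<open>
  The neighbors of \<open>S\<close> on which the heights are not forced to be \<open>1\<close>.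
\<close>

definition inner_nbrs :: "'a set \<Rightarrow> 'a set" where
  "inner_nbrs S = {u \<in> parcs G `` S. parcs G `` {u} \<subseteq> S}"

text \<open>
  Each inner neighbor sends all its \<open>d\<close> edges to \<open>S\<close>, which can receive only \<open>d |S|\<close> edges.
\<close>

lemma card_inner_nbrs_le:
  assumes "finite S"
  shows "card (inner_nbrs S) \<le> card S"
proof -
  let ?U = "inner_nbrs S"
  have "d * card ?U = edge_count G ?U S"
    by (rule edge_count_nbrs_subset[symmetric])
       (auto simp: inner_nbrs_def dest: edge_in_verts)
  also have "\<dots> = edge_count G S ?U" by (rule edge_count_commute)
  also have "\<dots> = (\<Sum>a\<in>S. card (parcs G `` {a} \<inter> ?U))"
    using assms by (rule edge_count_eq_sum)
  also have "\<dots> \<le> (\<Sum>a\<in>S. d)"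
  proof (rule sum_mono)
    fix a
    have "card (parcs G `` {a} \<inter> ?U) \<le> card (parcs G `` {a})"
      by (intro card_mono) auto
    also have "\<dots> \<le> d" using card_nbrs_of_set[of "{a}"] by simp
    finally show "card (parcs G `` {a} \<inter> ?U) \<le> d" .
  qed
  finally show ?thesis using d_ge_2 by simp
qed

definition anchor :: "'a set \<Rightarrow> 'a \<Rightarrow> 'a" where
  "anchor S u = (SOME y. y \<in> S \<and> (y, u) \<in> parcs G)"

lemma anchor:
  assumes "u \<in> parcs G `` S"
  shows "anchor S u \<in> S \<and> (anchor S u, u) \<in> parcs G"
proof -
  obtain y where "y \<in> S \<and> (y, u) \<in> parcs G" using assms by auto
  then show ?thesis unfolding anchor_def by (rule someI)
qed

text \<open>
  On the rim of the excursion the sign is a free choice, given by \<open>W\<close>. At an inner neighbor it is not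
  free: it records whether the height there was above or below that of a chosen neighbor in \<open>S\<close>, which
  is exactly what is needed to undo the flattening.
\<close>

definition flatten :: "'a set \<Rightarrow> 'a set \<Rightarrow> ('a \<Rightarrow> int) \<Rightarrow> 'a \<Rightarrow> int" where
  "flatten S W h w =
     (if w \<in> S then 0
      else if w \<in> parcs G `` S then
        (if (if w \<in> inner_nbrs S then h (anchor S w) < h w else w \<in> W) then 1 else - 1)
      else h w)"

text \<open>
  The modified region is left only by edges from the neighborhood of the excursion to vertices at
  height \<open>0\<close>, and these edges accept either sign.
\<close>

lemma flatten_in_heights:
  assumes i: "i \<in> {0, 1}" and h: "h \<in> heights i" and x: "x \<in> high i h"
  shows "flatten (excursion i h x) W h \<in> heights i"
proof -
  let ?S = "excursion i h x" and ?g = "flatten (excursion i h x) W h"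
  note S = excursion_subset_class[OF assms]
  note N = nbrs_subset[OF i S]
  have hs: "unit_steps h" and ext: "h \<in> pverts G \<rightarrow>\<^sub>E UNIV"
    and ac: "almost_constant V n d lam h i 0"
    using h by (auto simp: heights_def)
  have main: "\<bar>?g a - ?g b\<bar> = 1" if ab: "(a, b) \<in> parcs G" and a: "a \<in> V i" for a b
  proof -
    have b: "b \<notin> ?S" using edge_swaps_class[OF ab i] a S class_disjoint[OF i] by blast
    have aN: "a \<notin> parcs G `` ?S" using a N class_disjoint[OF i] by blast
    show ?thesis
    proof (cases "b \<in> parcs G `` ?S")
      case True
      have "?g a = 0"
        using height_beyond_excursion[OF assms True edge_sym[OF ab]] aN
        by (simp add: flatten_def)
      moreover have "\<bar>?g b\<bar> = 1" using True b by (simp add: flatten_def)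
      ultimately show ?thesis by simp
    next
      case False
      then have "a \<notin> ?S" using ab by auto
      then show ?thesis
        using False b aN unit_stepsD[OF hs ab] by (simp add: flatten_def)
    qed
  qed
  have "\<bar>?g a - ?g b\<bar> = 1" if ab: "(a, b) \<in> parcs G" for a b
  proof (cases "a \<in> V i")
    case True
    then show ?thesis by (rule main[OF ab])
  next
    case False
    then have "b \<in> V i"
      using edge_swaps_class[OF edge_sym[OF ab] i] edge_in_verts[OF ab] verts_eq_class[OF i] by blast
    then show ?thesis using main[OF edge_sym[OF ab]] by (simp add: abs_minus_commute)
  qed
  then have "unit_steps ?g" by (auto simp: unit_steps_def)
  moreover have "?g \<in> pverts G \<rightarrow>\<^sub>E UNIV"
  proof -
    have "?g w = undefined" if "w \<notin> pverts G" for w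
    proof -
      have "w \<notin> ?S" using that S class_subset[OF i] by blast
      moreover have "w \<notin> parcs G `` ?S" using that edge_in_verts by auto
      moreover have "h w = undefined" using ext that by (rule PiE_arb)
      ultimately show ?thesis by (simp add: flatten_def)
    qed
    then show ?thesis by (auto simp: PiE_def extensional_def)
  qed
  moreover have "almost_constant V n d lam ?g i 0"
  proof -
    have "{w \<in> V i. ?g w \<noteq> 0} \<subseteq> {w \<in> V i. h w \<noteq> 0}"
      using N class_disjoint[OF i] by (auto simp: flatten_def split: if_splits)
    then have "card {w \<in> V i. ?g w \<noteq> 0} \<le> card {w \<in> V i. h w \<noteq> 0}"
      using finite_class[OF i] by (intro card_mono) auto
    then show ?thesis using ac by (simp add: almost_constant_def)
  qed
  ultimately show ?thesis by (simp add: heights_def)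
qed

definition heights_with_profile :: "nat \<Rightarrow> 'a \<Rightarrow> ('a \<times> int) set \<Rightarrow> ('a \<Rightarrow> int) set" where
  "heights_with_profile i x P = {h \<in> heights i. x \<in> high i h \<and> profile i h x = P}"

lemma excursion_eq_of_profile: "profile i h x = P \<Longrightarrow> excursion i h x = fst ` P"
  by (force simp: profile_def)

text \<open>
  The profile gives the heights up to a common shift, and the shift is determined because the minimum
  over the excursion is \<open>2\<close>.
\<close>

lemma heights_agree_on_excursion:
  assumes i: "i \<in> {0, 1}" and h: "h \<in> heights_with_profile i x P"
    and h': "h' \<in> heights_with_profile i x P" and w: "w \<in> fst ` P"
  shows "h w = h' w"
proof -
  have *: "h w = h x + c" if "(w, c) \<in> P" "h \<in> heights_with_profile i x P" for h w c
    using that by (auto simp: heights_with_profile_def profile_def)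
  have ge: "h' x \<le> h x" if h: "h \<in> heights_with_profile i x P"
    and h': "h' \<in> heights_with_profile i x P" for h h'
  proof -
    have "h' \<in> heights i" "x \<in> high i h'" "excursion i h' x = fst ` P"
      using h' excursion_eq_of_profile by (auto simp: heights_with_profile_def)
    then obtain y where y: "y \<in> fst ` P" "h' y = 2"
      using excursion_reaches_2[OF i, of h' x] by auto
    have "y \<in> high i h"
      using y(1) excursion_subset_high[OF i, of h x] h excursion_eq_of_profile
      by (auto simp: heights_with_profile_def)
    then have "h y \<ge> 2" by (simp add: high_def)
    moreover obtain c where "(y, c) \<in> P" using y(1) by auto
    then have "h y = h x + c" "h' y = h' x + c" using * h h' by auto
    ultimately show ?thesis using y(2) by linarith
  qed
  have "h x = h' x" using ge h h' by (intro antisym) auto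
  moreover obtain c where "(w, c) \<in> P" using w by auto
  ultimately show ?thesis using * h h' by metis
qed

lemma inj_on_flatten:
  fixes P :: "('a \<times> int) set"
  assumes i: "i \<in> {0, 1}"
  defines "S \<equiv> fst ` P"
  shows "inj_on (\<lambda>(h, W). flatten S W h)
           (heights_with_profile i x P \<times> Pow (parcs G `` S - inner_nbrs S))"
proof (rule inj_onI, clarify)
  fix h W h' W'
  assume h: "h \<in> heights_with_profile i x P" and h': "h' \<in> heights_with_profile i x P"
    and W: "W \<subseteq> parcs G `` S - inner_nbrs S" and W': "W' \<subseteq> parcs G `` S - inner_nbrs S"
    and eq: "flatten S W h = flatten S W' h'"
  have eqw: "flatten S W h w = flatten S W' h' w" for w using eq by simp
  have on_S: "h w = h' w" if "w \<in> S" for w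
    using heights_agree_on_excursion[OF i h h'] that by (simp add: S_def)
  have props: "k \<in> heights i" "x \<in> high i k" "excursion i k x = S" "unit_steps k"
    if "k \<in> heights_with_profile i x P" for k
    using that excursion_eq_of_profile by (auto simp: heights_with_profile_def S_def heights_def)
  have S_class: "S \<subseteq> V i"
    using excursion_subset_class[OF i props(1,2)[OF h]] props(3)[OF h] by simp
  have disj: "S \<inter> parcs G `` S = {}"
    using S_class nbrs_subset[OF i S_class] class_disjoint[OF i] by blast
  have same: "h w = h' w" for w
  proof (cases "w \<in> S")
    case True
    then show ?thesis by (rule on_S)
  next
    case wS: False
    show ?thesis
    proof (cases "w \<in> parcs G `` S")
      case False
      then show ?thesis using eqw[of w] wS by (simp add: flatten_def)
    next
      case wN: True
      show ?thesis
      proof (cases "w \<in> inner_nbrs S")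
        case True
        have "h (anchor S w) < h w \<longleftrightarrow> h' (anchor S w) < h' w"
          using eqw[of w] wS wN True by (simp add: flatten_def split: if_splits)
        moreover have "h (anchor S w) = h' (anchor S w)" using anchor[OF wN] on_S by blast
        moreover have "\<bar>h (anchor S w) - h w\<bar> = 1" "\<bar>h' (anchor S w) - h' w\<bar> = 1"
          using anchor[OF wN] unit_stepsD[OF props(4)[OF h]] unit_stepsD[OF props(4)[OF h']] by auto
        ultimately show ?thesis by (cases "h (anchor S w) < h w") auto
      next
        case False
        then have "\<not> parcs G `` {w} \<subseteq> S" using wN by (simp add: inner_nbrs_def)
        then have "h w = 1" "h' w = 1"
          using height_at_rim[OF i props(1,2)[OF h]] height_at_rim[OF i props(1,2)[OF h']]
            props(3)[OF h] props(3)[OF h'] wN by simp_all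
        then show ?thesis by simp
      qed
    qed
  qed
  moreover have "W = W'"
  proof -
    have "w \<in> W \<longleftrightarrow> w \<in> W'" if w: "w \<in> parcs G `` S - inner_nbrs S" for w
    proof -
      have "w \<notin> S" using w disj by blast
      then show ?thesis
        using eqw[of w] w by (simp add: flatten_def split: if_splits)
    qed
    then show ?thesis using W W' by fast
  qed
  ultimately show "h = h' \<and> W = W'" by (intro conjI ext same)
qed

text \<open>
  The entropy gain of flattening: one free sign for every neighbor of \<open>S\<close> that is not an inner one.
\<close>

lemma card_heights_with_profile_le:
  fixes P :: "('a \<times> int) set"
  assumes i: "i \<in> {0, 1}"
  defines "S \<equiv> fst ` P"
  shows "card (heights_with_profile i x P) * 2 ^ card (parcs G `` S) \<le> card (heights i) * 2 ^ card S"
proof (cases "heights_with_profile i x P = {}")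
  case False
  let ?H = "heights_with_profile i x P" and ?T = "parcs G `` S" and ?U = "inner_nbrs S"
  obtain h where "h \<in> ?H" using False by auto
  then have "finite S"
    using finite_excursion[OF i, of h x] excursion_eq_of_profile[of i h x P]
    by (simp add: heights_with_profile_def S_def)
  have "(\<lambda>(h, W). flatten S W h) ` (?H \<times> Pow (?T - ?U)) \<subseteq> heights i"
    using flatten_in_heights[OF i] excursion_eq_of_profile
    by (auto simp: heights_with_profile_def S_def)
  then have "card (?H \<times> Pow (?T - ?U)) \<le> card (heights i)"
    using inj_on_flatten[OF i] finite_heights[OF i] unfolding S_def by (intro card_inj_on_le)
  then have *: "card ?H * 2 ^ card (?T - ?U) \<le> card (heights i)"
    by (simp add: card_cartesian_product card_Pow)
  have "card ?T = card (?T - ?U) + card ?U"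
    using card_Diff_subset[of ?U ?T] card_mono[of ?T ?U] by (auto simp: inner_nbrs_def intro: finite_subset[OF _ finite_nbrs])
  also have "\<dots> \<le> card (?T - ?U) + card S"
    using card_inner_nbrs_le[OF \<open>finite S\<close>] by simp
  finally have "card ?H * 2 ^ card ?T \<le> card ?H * 2 ^ (card (?T - ?U) + card S)"
    by (intro mult_left_mono power_increasing) auto
  also have "\<dots> \<le> card (heights i) * 2 ^ card S"
    using * by (simp add: power_add mult.assoc[symmetric])
  finally show ?thesis .
qed simp

section \<open>High vertices are rare\<close>

text \<open>
  In the union bound, \<open>s = |S|\<close>, \<open>\<tau> = |T|\<close>, and \<open>b\<close> is the size of the ball. The power of \<open>3 * d\<^sup>2\<close>
  counts profiles, one factor \<open>2 ^ s\<close> is the loss from the inner neighbors, the other one makes the sum over \<open>s\<close>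
  converge, and \<open>4\<close> pays for the two classes and the two directions.
\<close>

lemma entropy_bound:
  fixes s \<tau> b :: nat
  assumes s: "s \<ge> 1" and \<tau>: "75 * ln (real d) * real s \<le> real \<tau>" and b: "b \<le> s + \<tau>"
  shows "real ((3 * d\<^sup>2) ^ (2 * (s - 1)) * 2 ^ s) * 2 ^ s * 4 \<le> exp (- real b / 3) * 2 ^ \<tau>"
proof -
  define L where "L = ln (real d)"
  have d: "2 \<le> d" by (rule d_ge_2)
  have "3 * d\<^sup>2 \<le> d ^ 4"
  proof -
    have "3 \<le> d * d" using mult_mono[OF d d] by simp
    then have "3 * (d * d) \<le> (d * d) * (d * d)" by (rule mult_right_mono) simp
    then show ?thesis by (simp add: power2_eq_square power4_eq_xxxx mult.assoc)
  qed
  then have "(3 * d\<^sup>2) ^ (2 * (s - 1)) \<le> (d ^ 4) ^ (2 * (s - 1))" by (rule power_mono) simp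
  also have "\<dots> \<le> (d ^ 4) ^ (2 * s)" using d by (intro power_increasing) auto
  also have "\<dots> = d ^ (8 * s)" by (simp add: power_mult[symmetric])
  finally have 1: "(3 * d\<^sup>2) ^ (2 * (s - 1)) \<le> d ^ (8 * s)" .
  have 2: "2 ^ s \<le> d ^ s" using d by (rule power_mono) simp
  have 4: "4 \<le> d ^ (2 * s)"
  proof -
    have "4 \<le> d ^ 2" using mult_mono[OF d d] by (simp add: power2_eq_square)
    also have "\<dots> \<le> d ^ (2 * s)" using d s by (intro power_increasing) auto
    finally show ?thesis .
  qed
  \<comment> \<open>Everything is at most a power of \<open>d\<close>, as \<open>d \<ge> 2\<close>; the exponents add up to \<open>12 * s\<close>, and \<open>75 / 3 = 25\<close> exceeds \<open>12 + 1 / 2\<close>.\<close>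
  have "(3 * d\<^sup>2) ^ (2 * (s - 1)) * 2 ^ s * 2 ^ s * 4 \<le> d ^ (8 * s) * d ^ s * d ^ s * d ^ (2 * s)"
    by (intro mult_mono 1 2 4) auto
  also have "\<dots> = d ^ (12 * s)" by (simp add: power_add[symmetric])
  finally have "real ((3 * d\<^sup>2) ^ (2 * (s - 1)) * 2 ^ s * 2 ^ s * 4) \<le> real (d ^ (12 * s))"
    by (rule of_nat_mono)
  then have "real ((3 * d\<^sup>2) ^ (2 * (s - 1)) * 2 ^ s) * 2 ^ s * 4 \<le> real d ^ (12 * s)"
    by simp
  also have "\<dots> = exp (real (12 * s) * L)"
  proof -
    have "real d = exp L" using d by (simp add: L_def)
    then show ?thesis by (simp only: exp_of_nat_mult)
  qed
  also have "\<dots> \<le> exp (- real b / 3 + real \<tau> * ln 2)"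
  proof -
    have L: "2 / 3 \<le> L" using ln_d_ge by (simp add: L_def)
    have "real s * (2 / 3) \<le> real s * L" using L by (rule mult_left_mono) simp
    moreover have "75 * (real s * L) \<le> real \<tau>" using \<tau> by (simp add: L_def mult_ac)
    moreover have "real \<tau> * (2 / 3) \<le> real \<tau> * ln 2"
      using ln2_ge_two_thirds by (rule mult_left_mono) simp
    moreover have "real b \<le> real s + real \<tau>" using b by linarith
    ultimately have "12 * (real s * L) \<le> - real b / 3 + real \<tau> * ln 2"
      using of_nat_0_le_iff[of s, where ?'a = real] by linarith
    then show ?thesis by simp
  qed
  also have "\<dots> = exp (- real b / 3) * 2 ^ \<tau>"
    by (simp only: exp_add exp_of_nat_mult) simp
  finally show ?thesis .
qed

text \<open>
  The union bound over excursions, ordered by their size \<open>s\<close>. Excursions of size \<open>s\<close> contribute at most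
  a fraction \<open>2 ^ -s\<close> of the total bound.
\<close>

lemma card_high_heights_le:
  assumes i: "i \<in> {0, 1}" and v: "v \<in> pverts G" and t: "t \<ge> 1"
  shows "4 * real (card {h \<in> heights i. h v > int t})
    \<le> exp (- real (card (graph_ball G v t)) / 3) * real (card (heights i))"
proof -
  let ?B = "{h \<in> heights i. h v > int t}" and ?b = "card (graph_ball G v t)"
  define K where "K = exp (- real ?b / 3) * real (card (heights i))"
  \<comment> \<open>The root is chosen from \<open>v\<close> and \<open>i\<close> alone; if it varied with \<open>h\<close>, its choices would enter the count.\<close>
  obtain x where x: "x \<in> V i" "x = v \<or> (x, v) \<in> parcs G"
  proof (cases "v \<in> V i")
    case False
    then have vi: "v \<in> V (1 - i)" using v verts_eq_class[OF i] by blast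
    have "parcs G `` {v} \<noteq> {}" using card_nbrs[OF v] d_ge_2 by auto
    then obtain x where "(v, x) \<in> parcs G" by auto
    then have "(x, v) \<in> parcs G" "x \<in> V i"
      using edge_sym edge_swaps_class[OF _ i] vi by blast+
    then show ?thesis using that by blast
  qed (use that in blast)
  have x_high: "x \<in> high i h" if h: "h \<in> ?B" for h
  proof (cases "x = v")
    case True
    then show ?thesis using h x t by (auto simp: high_def)
  next
    case False
    then have "\<bar>h x - h v\<bar> = 1" using h x by (auto simp: heights_def unit_steps_def)
    moreover have "even (h x)" using heights_even[OF i _ x(1)] h by blast
    moreover have "h v \<ge> 2" using h t by auto
    ultimately have "h x \<ge> 2" by (cases "h x = 1") auto
    then show ?thesis using x by (simp add: high_def)
  qed
  define Q where "Q s = {P \<in> (\<lambda>h. profile i h x) ` ?B. card (fst ` P) = s}" for s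
  have finB: "finite ?B" using finite_heights[OF i] by simp
  have finQ: "finite (Q s)" for s using finB by (simp add: Q_def)
  have card_exc: "1 \<le> card (excursion i h x) \<and> card (excursion i h x) \<le> n" if "h \<in> ?B" for h
  proof -
    have h: "h \<in> heights i" "x \<in> high i h" using that x_high by auto
    have "excursion i h x \<noteq> {}" using root_in_excursion[OF i h] by auto
    then show ?thesis
      using finite_excursion[OF i h] card_mono[OF finite_class[OF i] excursion_subset_class[OF i h]]
        card_class[OF i] by (simp add: Suc_le_eq card_gt_0_iff)
  qed
  have "?B \<subseteq> (\<Union>s\<in>{1..n}. \<Union>P\<in>Q s. heights_with_profile i x P)"
  proof
    fix h assume h: "h \<in> ?B"
    let ?P = "profile i h x" and ?s = "card (excursion i h x)"
    have "?s \<in> {1..n}" using card_exc[OF h] by simp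
    moreover have "?P \<in> Q ?s"
      using h excursion_eq_of_profile[of i h x ?P] by (simp add: Q_def)
    moreover have "h \<in> heights_with_profile i x ?P"
      using h x_high[OF h] by (simp add: heights_with_profile_def)
    ultimately show "h \<in> (\<Union>s\<in>{1..n}. \<Union>P\<in>Q s. heights_with_profile i x P)" by blast
  qed
  then have "card ?B \<le> card (\<Union>s\<in>{1..n}. \<Union>P\<in>Q s. heights_with_profile i x P)"
    using finQ finite_heights[OF i] by (intro card_mono) (auto simp: heights_with_profile_def)
  also have "\<dots> \<le> (\<Sum>s\<in>{1..n}. card (\<Union>P\<in>Q s. heights_with_profile i x P))"
    by (rule card_UN_le) simp
  also have "\<dots> \<le> (\<Sum>s\<in>{1..n}. \<Sum>P\<in>Q s. card (heights_with_profile i x P))"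
    using finQ by (intro sum_mono card_UN_le)
  finally have union: "real (card ?B) \<le> (\<Sum>s\<in>{1..n}. \<Sum>P\<in>Q s. real (card (heights_with_profile i x P)))"
    by (simp only: of_nat_sum[symmetric] of_nat_le_iff)
  have level: "(\<Sum>P\<in>Q s. real (card (heights_with_profile i x P))) \<le> K / 4 * (1 / 2) ^ s"
    if s: "s \<in> {1..n}" for s
  proof -
    let ?D = "(3 * d\<^sup>2) ^ (2 * (s - 1))"
    have "Q s \<subseteq> traces climbs (2 * (s - 1)) (x, 0)"
    proof
      fix P assume "P \<in> Q s"
      then obtain h where h: "h \<in> ?B" "P = profile i h x" "card (fst ` P) = s" by (auto simp: Q_def)
      then have "card (excursion i h x) = s" using excursion_eq_of_profile[of i h x P] by simp
      then show "P \<in> traces climbs (2 * (s - 1)) (x, 0)"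
        using profile_is_trace[OF i, of h x] x_high[OF h(1)] h by auto
    qed
    then have cardQ: "card (Q s) \<le> ?D"
      using card_traces_le[of climbs "3 * d\<^sup>2" "2 * (s - 1)" "(x, 0)"] climbs_degree
        card_mono order_trans by blast
    have each: "real (card (heights_with_profile i x P)) * real ?D \<le> K / 4 * (1 / 2) ^ s" if PQ: "P \<in> Q s" for P
    proof -
      obtain h where h: "h \<in> ?B" "P = profile i h x" "card (fst ` P) = s"
        using PQ by (auto simp: Q_def)
      have hh: "h \<in> heights i" "x \<in> high i h" using h x_high by auto
      have S: "excursion i h x = fst ` P" using h excursion_eq_of_profile by blast
      define \<tau> where "\<tau> = card (parcs G `` (fst ` P))"
      have exp: "75 * ln (real d) * real s \<le> real \<tau>"
        using small_set_expands[OF i excursion_subset_class[OF i hh] card_excursion_le[OF i hh]]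
        by (simp add: S h(3) \<tau>_def)
      have "v \<in> excursion i h x \<union> parcs G `` excursion i h x"
        using x(2) root_in_excursion[OF i hh] by blast
      then have "graph_ball G v t \<subseteq> fst ` P \<union> parcs G `` (fst ` P)"
        using graph_ball_subset_excursion[OF i hh] h(1) S by auto
      then have "?b \<le> card (fst ` P \<union> parcs G `` (fst ` P))"
        using finite_excursion[OF i hh] S by (intro card_mono) auto
      also have "\<dots> \<le> s + \<tau>" using card_Un_le h(3) \<tau>_def by metis
      finally have b: "?b \<le> s + \<tau>" .
      define c where "c = real (card (heights_with_profile i x P))"
      have "card (heights_with_profile i x P) * 2 ^ \<tau> \<le> card (heights i) * 2 ^ s"
        using card_heights_with_profile_le[OF i, of x P] by (simp add: \<tau>_def h(3))
      then have "real (card (heights_with_profile i x P) * 2 ^ \<tau>) \<le> real (card (heights i) * 2 ^ s)"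
        by (rule of_nat_mono)
      then have c: "c * 2 ^ \<tau> \<le> real (card (heights i)) * 2 ^ s" by (simp add: c_def)
      have "(c * 2 ^ \<tau>) * (real (?D * 2 ^ s) * 4) \<le> (real (card (heights i)) * 2 ^ s) * (real (?D * 2 ^ s) * 4)"
        using c by (rule mult_right_mono) simp
      also have "\<dots> = real (card (heights i)) * (real (?D * 2 ^ s) * 2 ^ s * 4)"
        by (simp only: mult_ac)
      also have "\<dots> \<le> real (card (heights i)) * (exp (- real ?b / 3) * 2 ^ \<tau>)"
        using entropy_bound[OF _ exp b] s by (intro mult_left_mono) auto
      finally have "(c * real ?D * (4 * 2 ^ s)) * 2 ^ \<tau> \<le> K * 2 ^ \<tau>"
        by (simp add: K_def mult_ac)
      then have "c * real ?D * (4 * 2 ^ s) \<le> K"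
        by (rule mult_right_le_imp_le) simp
      then show ?thesis by (simp add: c_def field_simps)
    qed
    show ?thesis
    proof -
      have D: "real ?D > 0" using d_ge_2 by simp
      have "(\<Sum>P\<in>Q s. real (card (heights_with_profile i x P)))
          \<le> (\<Sum>P\<in>Q s. K / 4 * (1 / 2) ^ s / real ?D)"
      proof (rule sum_mono)
        fix P assume "P \<in> Q s"
        from each[OF this] show "real (card (heights_with_profile i x P)) \<le> K / 4 * (1 / 2) ^ s / real ?D"
          using D by (simp only: pos_le_divide_eq)
      qed
      also have "\<dots> = real (card (Q s)) * (K / 4 * (1 / 2) ^ s / real ?D)" by (simp only: sum_constant)
      also have "\<dots> \<le> real ?D * (K / 4 * (1 / 2) ^ s / real ?D)"
        using cardQ by (intro mult_right_mono of_nat_mono) (simp_all add: K_def)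
      also have "\<dots> = K / 4 * (1 / 2) ^ s"
        using D by (metis less_irrefl nonzero_mult_div_cancel_left times_divide_eq_right)
      finally show ?thesis .
    qed
  qed
  have "(\<Sum>s\<in>{1..n}. (1 / 2 :: real) ^ s) \<le> 1"
  proof -
    have "(\<Sum>s\<in>{1..m}. (1 / 2 :: real) ^ s) = 1 - (1 / 2) ^ m" for m :: nat
      by (induction m) auto
    then show ?thesis by simp
  qed
  then have "K / 4 * (\<Sum>s\<in>{1..n}. (1 / 2 :: real) ^ s) \<le> K / 4 * 1"
    by (intro mult_left_mono) (auto simp: K_def)
  moreover have "real (card ?B) \<le> K / 4 * (\<Sum>s\<in>{1..n}. (1 / 2 :: real) ^ s)"
    using order_trans[OF union sum_mono[OF level]] by (simp only: sum_distrib_left)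
  ultimately have "real (card ?B) \<le> K / 4" by linarith
  then show ?thesis by (simp add: K_def)
qed

section \<open>From heights back to homomorphisms\<close>

text \<open>
  Reflecting by the sign \<open>\<sigma>\<close> turns both directions of deviation into an upward one. The phase itself
  need not be remembered, because \<open>f v\<^sub>0 = 0\<close> restores it.
\<close>

lemma card_deviating_le:
  assumes v\<^sub>0: "v\<^sub>0 \<in> pverts G" and \<sigma>: "\<sigma> \<in> {1, - 1 :: int}" and i: "i \<in> {0, 1}"
    and v: "v \<in> pverts G"
  shows "card {f \<in> Hom G v\<^sub>0. phase_class V n d lam f = i \<and> \<sigma> * (f v - phase V n d lam f) > int t}
    \<le> card {h \<in> heights i. h v > int t}" (is "card ?F \<le> _")
proof (rule card_inj_on_le)
  define relative where "relative f = restrict (\<lambda>w. \<sigma> * (f w - phase V n d lam f)) (pverts G)" for f :: "'a \<Rightarrow> int"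
  have \<sigma>2: "\<sigma> * \<sigma> = 1" using \<sigma> by auto
  show "inj_on relative ?F"
  proof (rule inj_onI)
    fix f g assume f: "f \<in> ?F" and g: "g \<in> ?F" and eq: "relative f = relative g"
    have recover: "f w = \<sigma> * (relative f w - relative f v\<^sub>0)" if "f \<in> ?F" "w \<in> pverts G" for f w
    proof -
      have "\<sigma> * (relative f w - relative f v\<^sub>0) = (\<sigma> * \<sigma>) * (f w - f v\<^sub>0)"
        using that v\<^sub>0 by (simp add: relative_def algebra_simps)
      then show ?thesis using that by (simp add: \<sigma>2 Hom_def)
    qed
    have "f w = g w" if "w \<in> pverts G" for w
      using recover[OF f that] recover[OF g that] eq by simp
    moreover have "f \<in> pverts G \<rightarrow>\<^sub>E UNIV" "g \<in> pverts G \<rightarrow>\<^sub>E UNIV"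
      using f g by (auto simp: Hom_def)
    ultimately show "f = g" by (intro PiE_ext)
  qed
  show "relative ` ?F \<subseteq> {h \<in> heights i. h v > int t}"
  proof (rule image_subsetI)
    fix f assume f: "f \<in> ?F"
    let ?k = "phase V n d lam f"
    have steps: "unit_steps f" using f by (auto simp: Hom_def unit_steps_def)
    have "unit_steps (relative f)"
      unfolding unit_steps_def
    proof clarify
      fix u w assume uw: "(u, w) \<in> parcs G"
      have "relative f u - relative f w = \<sigma> * (f u - f w)"
        using edge_in_verts[OF uw] by (simp add: relative_def algebra_simps)
      then show "\<bar>relative f u - relative f w\<bar> = 1"
        using unit_stepsD[OF steps uw] \<sigma> by (auto simp: abs_mult)
    qed
    moreover have "almost_constant V n d lam (relative f) i 0"
    proof -
      have "{w \<in> V i. relative f w \<noteq> 0} = {w \<in> V i. f w \<noteq> ?k}"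
        using class_subset[OF i] \<sigma> by (auto simp: relative_def)
      then show ?thesis
        using phase_almost_constant(2)[OF steps] f by (simp add: almost_constant_def)
    qed
    moreover have "relative f v > int t" using f v by (simp add: relative_def)
    ultimately show "relative f \<in> {h \<in> heights i. h v > int t}"
      by (simp add: heights_def relative_def)
  qed
  show "finite {h \<in> heights i. h v > int t}" using finite_heights[OF i] by simp
qed

lemma prob_deviation_le:
  assumes v\<^sub>0: "v\<^sub>0 \<in> V 0" and t: "t \<ge> 1" and v: "v \<in> pverts G"
  shows "measure_pmf.prob (pmf_of_set (Hom G v\<^sub>0)) {f. \<bar>f v - phase V n d lam f\<bar> > int t}
         \<le> exp (- real (card (graph_ball G v t)) / 3)"
proof -
  let ?ph = "phase V n d lam" and ?cl = "phase_class V n d lam"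
  let ?e = "exp (- real (card (graph_ball G v t)) / 3)"
  have v0: "v\<^sub>0 \<in> pverts G" using v\<^sub>0 class_subset[of 0] by auto
  note H = finite_Hom[OF v0] Hom_nonempty[OF v\<^sub>0]
  define F where "F \<sigma> i = {f \<in> Hom G v\<^sub>0. ?cl f = i \<and> \<sigma> * (f v - ?ph f) > int t}" for \<sigma> i
  let ?I = "{1, - 1 :: int} \<times> {0, 1 :: nat}"
  have "Hom G v\<^sub>0 \<inter> {f. \<bar>f v - ?ph f\<bar> > int t} \<subseteq> (\<Union>(\<sigma>, i)\<in>?I. F \<sigma> i)"
  proof
    fix f assume f: "f \<in> Hom G v\<^sub>0 \<inter> {f. \<bar>f v - ?ph f\<bar> > int t}"
    then have "unit_steps f" by (auto simp: Hom_def unit_steps_def)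
    then have cl: "?cl f \<in> {0, 1}" by (rule phase_almost_constant)
    have "\<exists>\<sigma>\<in>{1, - 1}. \<sigma> * (f v - ?ph f) > int t" using f by auto
    then obtain \<sigma> where \<sigma>: "\<sigma> \<in> {1, - 1}" "\<sigma> * (f v - ?ph f) > int t" by blast
    then have "f \<in> F \<sigma> (?cl f)" using f by (simp add: F_def)
    with \<sigma>(1) show "f \<in> (\<Union>(\<sigma>, i)\<in>?I. F \<sigma> i)"
      using cl by (intro UN_I[of "(\<sigma>, ?cl f)"]) auto
  qed
  then have "card (Hom G v\<^sub>0 \<inter> {f. \<bar>f v - ?ph f\<bar> > int t}) \<le> card (\<Union>(\<sigma>, i)\<in>?I. F \<sigma> i)"
    using H by (intro card_mono) (auto simp: F_def)
  also have "\<dots> \<le> (\<Sum>(\<sigma>, i)\<in>?I. card (F \<sigma> i))"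
    using card_UN_le[of ?I "\<lambda>(\<sigma>, i). F \<sigma> i"] by (simp add: case_prod_unfold)
  finally have "real (card (Hom G v\<^sub>0 \<inter> {f. \<bar>f v - ?ph f\<bar> > int t})) \<le> (\<Sum>(\<sigma>, i)\<in>?I. real (card (F \<sigma> i)))"
    by (simp only: of_nat_sum[symmetric] of_nat_le_iff case_prod_unfold)
  also have "\<dots> \<le> (\<Sum>(\<sigma>, i)\<in>?I. ?e / 4 * real (card (Hom G v\<^sub>0)))"
  proof (rule sum_mono, clarify)
    fix \<sigma> i assume "\<sigma> \<in> {1, - 1 :: int}" and i: "i \<in> {0, 1 :: nat}"
    then have "card (F \<sigma> i) \<le> card {h \<in> heights i. h v > int t}"
      unfolding F_def by (intro card_deviating_le v0 v)
    then have "4 * real (card (F \<sigma> i)) \<le> 4 * real (card {h \<in> heights i. h v > int t})" by simp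
    also have "\<dots> \<le> ?e * real (card (heights i))" by (rule card_high_heights_le[OF i v t])
    also have "\<dots> \<le> ?e * real (card (Hom G v\<^sub>0))"
      using heights_into_Hom[OF i v0] by (intro mult_left_mono) auto
    finally show "real (card (F \<sigma> i)) \<le> ?e / 4 * real (card (Hom G v\<^sub>0))" by simp
  qed
  also have "\<dots> = ?e * real (card (Hom G v\<^sub>0))"
    by (simp add: card_cartesian_product)
  finally show ?thesis
    using H by (simp add: measure_pmf_of_set pos_divide_le_eq card_gt_0_iff)
qed

end

theorem theorem1p5:
  fixes G :: "'a pair_pre_digraph" and V :: "nat \<Rightarrow> 'a set"
    and n d t :: nat and lam :: real and v\<^sub>0 v :: 'a
  assumes "good_bi_expander G V n d lam"
    and "Digraph_Component.connected (with_proj G)"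
    and "v\<^sub>0 \<in> V 0"
    and "t \<ge> 1"
    and "v \<in> pverts G"
  shows "measure_pmf.prob (pmf_of_set (Hom G v\<^sub>0))
           {f. \<bar>f v - phase V n d lam f\<bar> > int t}
         \<le> exp (- real (card (graph_ball G v t)) / 3)"
proof -
  interpret connected_good_bi_expander G V n d lam
    using assms by unfold_locales
  show ?thesis using assms by (intro prob_deviation_le)
qed

end
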